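(* Let $n\geqslant4$, let $\alpha\in[0,1]$, $\beta:=1-\alpha$, and let $f_\alpha(t):=t^n-\beta t-\alpha$. Let $1,\lambda_2,\dots,\lambda_n$ be the zeros of $f_\alpha$ (note $f_\alpha(1)=0$), listed with multiplicity, and let $$S=S(\alpha)=\begin{bmatrix}1&1&\cdots&1\\1&\lambda_2&\cdots&\lambda_n\\ \vdots&\vdots&\ddots&\vdots\\1&\lambda_2^{n-1}&\cdots&\lambda_n^{n-1}\end{bmatrix}$$ be the Vandermonde matrix corresponding to the zeros of $f_\alpha$. (i) If $n$ is even, then $S$ is ideal and extremal. (ii) If $n$ is odd and $\alpha\geqslant\beta$, then $S$ is ideal and extremal. (iii) If $n$ is odd, $\alpha<\beta$, and $(n-1)^{n-1}\beta^n-n^n\alpha^{n-1}\neq0$, then $S$ is ideal and extremal.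
   Context: A matrix $A\geqslant 0$ (nonnegative) has real nonnegative entries. An $n\times n$ matrix with $n\geqslant 2$ is reducible if it is permutation-similar to a block upper triangular matrix with two nonempty square diagonal blocks; a square matrix that is not reducible is irreducible. An invertible complex matrix $S$ is a Perron similarity if $SDS^{-1}$ is irreducible and nonnegative for some diagonal matrix $D$. For $x\in\mathbb{C}^n$, $D_x$ is the diagonal matrix with diagonal $x$, $M_x:=SD_xS^{-1}$, and $e$ is the all-ones vector. Put $\mathcal{C}(S):=\{x\in\mathbb{C}^n\mid M_x\geqslant0\}$ and $\mathcal{P}(S):=\{x\in\mathcal{C}(S)\mid M_xe=e\}$. The row cone $\mathcal{C}_r(S)$ is the set of all linear combinations with nonnegative real coefficients of the rows of $S$ (viewed as column vectors). A Perron similarity $S$ is ideal if $\mathcal{C}(S)=\mathcal{C}_r(S)$. A stochastic matrix is a nonnegative matrix all of whose row sums equal $1$. Let $\mathbb{SL}_1^n$ be the set of $x\in\mathbb{C}^n$ with $x_1=1$ such that the multiset $\{x_1,\dots,x_n\}$ is the spectrum of some $n\times n$ stochastic matrix, and let $\pi_1:\mathbb{C}^n\to\mathbb{C}^{n-1}$ delete the first coordinate. A point $x\in\mathbb{SL}_1^n$ is extremal if $\gamma\,\pi_1(x)\notin\pi_1(\mathbb{SL}_1^n)$ for all $\gamma>1$. A Perron similarity $S$ is extremal if $\mathcal{P}(S)$ contains an extremal point of $\mathbb{SL}_1^n$ other than $e$.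
   Formalization: At α=0, (i) and (iii) fail: every SDS⁻¹ has first column a multiple of e₁, so is reducible and S is not a Perron similarity. There the formal theorem asserts only that S is invertible, 𝒞(S)=𝒞_r(S), and 𝒫(S) contains an extremal point other than e. *)

theory Defs
  imports
    Complex_Main
    "HOL-Library.Nonpos_Ints"
    "HOL-Computational_Algebra.Computational_Algebra"
    "HOL-Combinatorics.Permutations"
    "Jordan_Normal_Form.Matrix"
    "Jordan_Normal_Form.Gauss_Jordan_Elimination"
    "Jordan_Normal_Form.Char_Poly"
begin

text \<open>Indices start at 0, so the first coordinate of a vector \<open>x\<close> is \<open>x $ 0\<close>.\<close>

definition nonneg_matrix :: "complex mat \<Rightarrow> bool" where
  "nonneg_matrix A \<longleftrightarrow> elements_mat A \<subseteq> \<real>\<^sub>\<ge>\<^sub>0"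

definition perm_matrix :: "nat \<Rightarrow> (nat \<Rightarrow> nat) \<Rightarrow> complex mat" where
  "perm_matrix n p = mat n n (\<lambda>(i, j). if j = p i then 1 else 0)"

definition reducible_matrix :: "nat \<Rightarrow> complex mat \<Rightarrow> bool" where
  "reducible_matrix n A \<longleftrightarrow> n \<ge> 2 \<and> A \<in> carrier_mat n n \<and>
     (\<exists>p k B C D. p permutes {0..<n} \<and> 0 < k \<and> k < n \<and>
        B \<in> carrier_mat k k \<and> C \<in> carrier_mat k (n - k) \<and> D \<in> carrier_mat (n - k) (n - k) \<and>
        perm_matrix n p * A * transpose_mat (perm_matrix n p) =
          four_block_mat B C (0\<^sub>m (n - k) k) D)"

definition irreducible_matrix :: "nat \<Rightarrow> complex mat \<Rightarrow> bool" where
  "irreducible_matrix n A \<longleftrightarrow> A \<in> carrier_mat n n \<and> \<not> reducible_matrix n A"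

text \<open>The library's \<open>mat_inverse\<close> is option-valued; \<open>matrix_inverse S\<close> is meaningful only
  for invertible \<open>S\<close>.\<close>

definition matrix_inverse :: "complex mat \<Rightarrow> complex mat" where
  "matrix_inverse S = the (mat_inverse S)"

definition perron_similarity :: "nat \<Rightarrow> complex mat \<Rightarrow> bool" where
  "perron_similarity n S \<longleftrightarrow> S \<in> carrier_mat n n \<and> invertible_mat S \<and>
     (\<exists>D \<in> carrier_mat n n. diagonal_mat D \<and>
        irreducible_matrix n (S * D * matrix_inverse S) \<and>
        nonneg_matrix (S * D * matrix_inverse S))"

definition M_mat :: "nat \<Rightarrow> complex mat \<Rightarrow> complex vec \<Rightarrow> complex mat" where
  "M_mat n S x = S * mat_diag n (\<lambda>i. x $ i) * matrix_inverse S"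

definition ones_vec :: "nat \<Rightarrow> complex vec" where
  "ones_vec n = vec n (\<lambda>_. 1)"

definition spectracone :: "nat \<Rightarrow> complex mat \<Rightarrow> complex vec set" where
  "spectracone n S = {x \<in> carrier_vec n. nonneg_matrix (M_mat n S x)}"

definition spectratope :: "nat \<Rightarrow> complex mat \<Rightarrow> complex vec set" where
  "spectratope n S = {x \<in> spectracone n S. M_mat n S x *\<^sub>v ones_vec n = ones_vec n}"

definition row_cone :: "nat \<Rightarrow> complex mat \<Rightarrow> complex vec set" where
  "row_cone n S = {vec n (\<lambda>j. \<Sum>i<n. complex_of_real (c i) * row S i $ j) | c :: nat \<Rightarrow> real.
     \<forall>i<n. c i \<ge> 0}"

definition ideal_similarity :: "nat \<Rightarrow> complex mat \<Rightarrow> bool" where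
  "ideal_similarity n S \<longleftrightarrow> perron_similarity n S \<and> spectracone n S = row_cone n S"

definition stochastic_matrix :: "nat \<Rightarrow> complex mat \<Rightarrow> bool" where
  "stochastic_matrix n A \<longleftrightarrow> A \<in> carrier_mat n n \<and> nonneg_matrix A \<and>
     (\<forall>i<n. (\<Sum>j<n. A $$ (i, j)) = 1)"

text \<open>The spectrum is the multiset of eigenvalues with algebraic multiplicity, that is, the
  multiset of roots of the characteristic polynomial.\<close>

definition SL1 :: "nat \<Rightarrow> complex vec set" where
  "SL1 n = {x \<in> carrier_vec n. x $ 0 = 1 \<and>
     (\<exists>A. stochastic_matrix n A \<and> mset (list_of_vec x) = proots (char_poly A))}"

definition proj1 :: "complex vec \<Rightarrow> complex vec" where
  "proj1 x = vec (dim_vec x - 1) (\<lambda>i. x $ Suc i)"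

definition extremal_point :: "nat \<Rightarrow> complex vec \<Rightarrow> bool" where
  "extremal_point n x \<longleftrightarrow> x \<in> SL1 n \<and>
     (\<forall>\<gamma>::real. \<gamma> > 1 \<longrightarrow> complex_of_real \<gamma> \<cdot>\<^sub>v proj1 x \<notin> proj1 ` SL1 n)"

definition has_extremal_point :: "nat \<Rightarrow> complex mat \<Rightarrow> bool" where
  "has_extremal_point n S \<longleftrightarrow>
     (\<exists>x \<in> spectratope n S. extremal_point n x \<and> x \<noteq> ones_vec n)"

definition extremal_similarity :: "nat \<Rightarrow> complex mat \<Rightarrow> bool" where
  "extremal_similarity n S \<longleftrightarrow> perron_similarity n S \<and> has_extremal_point n S"

definition f_poly :: "nat \<Rightarrow> real \<Rightarrow> complex poly" where
  "f_poly n \<alpha> = monom 1 n - [:complex_of_real \<alpha>, complex_of_real (1 - \<alpha>):]"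

definition vandermonde :: "nat \<Rightarrow> complex vec \<Rightarrow> complex mat" where
  "vandermonde n lam = mat n n (\<lambda>(i, j). (lam $ j) ^ i)"

text \<open>For \<open>S = vandermonde n lam\<close> with \<open>lam\<close> the zeros of \<open>f_poly n \<alpha>\<close> (assumed
  distinct), every \<open>M_mat n S x\<close> is a polynomial in the companion matrix of \<open>f_poly n \<alpha>\<close>.
  If \<open>\<alpha> = 0\<close>, the first column of that matrix is zero, so each \<open>M_mat n S x\<close> has
  zeros below the diagonal in its first column and is reducible. Hence \<open>S\<close> is not a Perron similarity
  when \<open>\<alpha> = 0\<close>, and only the conditions that \<open>ideal_similarity\<close> and
  \<open>extremal_similarity\<close> add to it (together with invertibility) can then be asserted.\<close>

end

theory Submission
  imports Defs "Jordan_Normal_Form.Schur_Decomposition"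
begin

text \<open>
  Everything follows from the companion matrix \<open>C\<close> of \<open>f_poly n \<alpha>\<close>. It is nonnegative with row sums
  1, it has zero trace, and it satisfies \<open>C * S = S * D\<close> with \<open>D\<close> the diagonal matrix of the zeros,
  because each column of \<open>S\<close> lists the powers of a zero (\<open>companion_vandermonde\<close>). The arithmetic
  hypotheses enter only through separability: a double zero is real and forces \<open>n\<close> to be odd and
  the discriminant expression to vanish (\<open>f_poly_double_root\<close>). So in all three cases the zeros
  are distinct, \<open>S\<close> is invertible, and \<open>C = S * D * S\<^sup>-\<^sup>1\<close>.

  \<^emph>\<open>The cone.\<close> The \<open>i\<close>-th row of \<open>S\<close> is the vector of \<open>i\<close>-th powers of the zeros, so its matrix
  \<open>M\<close> is \<open>C\<close> to the power \<open>i\<close>, which is nonnegative; as \<open>M\<close> is linear in the vector, the row cone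
  lies in the spectracone. Conversely, row 0 of \<open>S\<close> is all ones, so comparing row 0 on both sides of
  \<open>M\<^sub>x * S = S * D\<^sub>x\<close> writes \<open>x\<close> as a combination of the rows of \<open>S\<close> whose coefficients are the
  entries of row 0 of \<open>M\<^sub>x\<close>; these are nonnegative when \<open>x\<close> lies in the spectracone
  (\<open>spectracone_eq_row_cone\<close>).

  \<^emph>\<open>Irreducibility.\<close> For \<open>\<alpha> \<noteq> 0\<close> the digraph of \<open>C\<close> contains a cycle through all indices
  (\<open>irreducible_matrix_if_cycle\<close>).

  \<^emph>\<open>Extremality.\<close> The extremal point is the vector of zeros itself. Its coordinates sum to the
  trace of \<open>C\<close>, which is 0, so the zeros other than 1 sum to \<open>-1\<close>. Scaling them by \<open>\<gamma> > 1\<close> would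
  produce a stochastic matrix with the negative trace \<open>1 - \<gamma>\<close> (\<open>extremal_point_if_sum_zero\<close>).
\<close>

section \<open>Separability of the trinomial\<close>

text \<open>With \<open>\<beta> = 1 - \<alpha>\<close>, a double zero satisfies \<open>z ^ n = \<beta> * z + \<alpha>\<close> and \<open>n * z ^ (n - 1) = \<beta>\<close>.
  Multiplying the second equation by \<open>z\<close> and eliminating \<open>z ^ n\<close> gives a linear equation, which
  excludes \<open>\<beta> = 0\<close> (then \<open>\<alpha> = 1\<close>) and shows that
  \<open>z = - n * \<alpha> / ((n - 1) * \<beta>)\<close> is real and at most 0. The \<open>(n - 1)\<close>-st power of this number is
  positive, hence \<open>n - 1\<close> is even, and substituting it back gives the vanishing of the discriminant.\<close>

lemma f_poly_double_root:
  assumes n: "n \<ge> 2" and \<alpha>: "0 \<le> \<alpha>" "\<alpha> \<le> 1"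
    and z: "poly (f_poly n \<alpha>) z = 0" "poly (pderiv (f_poly n \<alpha>)) z = 0"
  shows "odd n" "(real n - 1) ^ (n - 1) * (1 - \<alpha>) ^ n = real n ^ n * \<alpha> ^ (n - 1)"
proof -
  define \<beta> where "\<beta> = 1 - \<alpha>"
  obtain m where m: "n = Suc m" "m \<ge> 1" using n by (cases n) auto
  define r where "r = real n * \<alpha> / (real m * \<beta>)"
  have e1: "z ^ n = of_real \<alpha> + of_real \<beta> * z"
    using z(1) by (simp add: f_poly_def \<beta>_def poly_monom algebra_simps)
  have e2: "of_nat n * z ^ m = of_real \<beta>"
    using z(2) m by (simp add: f_poly_def \<beta>_def pderiv_diff pderiv_monom pderiv_pCons poly_monom)
  have "of_nat n * z ^ n = (of_nat n * z ^ m) * z" using m by simp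
  hence "of_nat n * (of_real \<alpha> + of_real \<beta> * z) = of_real \<beta> * z" unfolding e1 e2 .
  hence lin: "of_nat m * of_real \<beta> * z = - (of_nat n * of_real \<alpha>)"
    using m by (simp add: algebra_simps) (metis add_eq_0_iff add.commute)
  have \<beta>0: "\<beta> > 0"
  proof (rule ccontr)
    assume "\<not> \<beta> > 0"
    hence "\<beta> = 0" "\<alpha> = 1" using \<alpha> by (auto simp: \<beta>_def)
    thus False using lin n by simp
  qed
  have mb: "of_nat m * of_real \<beta> \<noteq> (0 :: complex)" using \<beta>0 m by simp
  have zr: "z = of_real (- r)"
    using lin mb \<beta>0 m by (simp add: r_def field_simps)
  have "complex_of_real (real n * (- r) ^ m) = of_real \<beta>"
    using e2 unfolding zr by simp
  hence e3: "real n * (- r) ^ m = \<beta>" using of_real_eq_iff by blast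
  have r0: "r \<ge> 0" using \<beta>0 \<alpha> by (simp add: r_def)
  have ev: "even m"
  proof (rule ccontr)
    assume "odd m"
    hence "(- r) ^ m \<le> 0" using r0 by simp
    hence "real n * (- r) ^ m \<le> 0" by (simp add: mult_nonneg_nonpos)
    thus False using e3 \<beta>0 by simp
  qed
  thus "odd n" using m by simp
  have "real n * r ^ m = \<beta>" using e3 ev by simp
  hence "real n * (real n * \<alpha>) ^ m = \<beta> * (real m * \<beta>) ^ m"
    using \<beta>0 m by (simp add: r_def power_divide field_simps)
  hence "real m ^ m * \<beta> ^ n = real n ^ n * \<alpha> ^ m"
    using m(1) by (simp add: power_mult_distrib mult.assoc mult.left_commute)
  thus "(real n - 1) ^ (n - 1) * (1 - \<alpha>) ^ n = real n ^ n * \<alpha> ^ (n - 1)"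
    using m(1) by (simp add: \<beta>_def)
qed

text \<open>In the range \<open>\<alpha> \<ge> \<beta>\<close> the discriminant cannot vanish: \<open>\<beta> ^ n \<le> \<alpha> ^ (n - 1)\<close> because
  \<open>\<beta> \<le> 1\<close>, while \<open>(n - 1) ^ (n - 1) < n ^ n\<close> and \<open>\<alpha> > 0\<close>.\<close>

lemma critical_value_bound:
  assumes "n \<ge> 2" "0 \<le> \<beta>" "\<beta> \<le> \<alpha>" "\<beta> = 1 - \<alpha>"
  shows "(real n - 1) ^ (n - 1) * \<beta> ^ n < real n ^ n * \<alpha> ^ (n - 1)"
proof -
  obtain m where m: "n = Suc m" "m \<ge> 1" using assms by (cases n) auto
  have a: "\<alpha> > 0" "\<beta> \<le> 1" using assms by auto
  have "\<beta> ^ n \<le> \<beta> ^ m" using m a assms by (intro power_decreasing) auto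
  also have "\<dots> \<le> \<alpha> ^ m" using assms by (intro power_mono) auto
  finally have 1: "\<beta> ^ n \<le> \<alpha> ^ m" .
  have "real m ^ m * \<beta> ^ n \<le> real m ^ m * \<alpha> ^ m" using 1 by (intro mult_left_mono) auto
  also have "\<dots> \<le> real n ^ m * \<alpha> ^ m"
    using a m by (intro mult_right_mono power_mono) auto
  also have "\<dots> < real n ^ n * \<alpha> ^ m" using a m by (intro mult_strict_right_mono) auto
  finally show ?thesis using m by simp
qed

lemma distinct_roots_list:
  assumes "rsquarefree p" and "mset xs = proots p"
  shows "distinct xs"
proof -
  have "p \<noteq> 0" using assms(1) by (simp add: rsquarefree_def)
  have "count (mset xs) a = (if a \<in> set xs then 1 else 0)" for a
  proof -
    have "count (mset xs) a \<in> {0, 1}"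
      using assms \<open>p \<noteq> 0\<close> by (simp add: rsquarefree_def)
    thus ?thesis using count_mset_0_iff[of xs a] by auto
  qed
  thus ?thesis by (simp add: distinct_count_atmost_1)
qed

section \<open>The trace as the sum of the spectrum\<close>

definition mat_trace :: "'a :: comm_semiring_0 mat \<Rightarrow> 'a" where
  "mat_trace A = (\<Sum>i<dim_row A. A $$ (i, i))"

lemma mat_trace_mult_commute:
  assumes "A \<in> carrier_mat n m" "B \<in> carrier_mat m n"
  shows "mat_trace (A * B) = mat_trace (B * A)"
proof -
  have "mat_trace (A * B) = (\<Sum>i<n. \<Sum>j<m. A $$ (i, j) * B $$ (j, i))"
    using assms by (simp add: mat_trace_def scalar_prod_def atLeast0LessThan)
  also have "\<dots> = (\<Sum>j<m. \<Sum>i<n. B $$ (j, i) * A $$ (i, j))"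
    by (subst sum.swap) (simp add: mult.commute)
  also have "\<dots> = mat_trace (B * A)"
    using assms by (simp add: mat_trace_def scalar_prod_def atLeast0LessThan)
  finally show ?thesis .
qed

lemma proots_prod_linear:
  "proots (\<Prod>a\<leftarrow>as. [:- a, 1 :: 'a :: idom:]) = mset as"
proof (induction as)
  case (Cons a as)
  have "(\<Prod>a\<leftarrow>as. [:- a, 1 :: 'a:]) \<noteq> 0" by (auto simp: prod_list_zero_iff)
  thus ?case using Cons by (simp add: proots_mult del: mult_pCons_left)
qed simp

text \<open>A Schur decomposition is a similarity to an upper triangular matrix whose diagonal lists the
  zeros of the characteristic polynomial, and similarity preserves the trace by
  \<open>mat_trace_mult_commute\<close>.\<close>

lemma mat_trace_eq_sum_spectrum:
  fixes A :: "complex mat"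
  assumes A: "A \<in> carrier_mat n n"
  shows "mat_trace A = sum_mset (proots (char_poly A))"
proof -
  obtain es where es: "char_poly A = (\<Prod>e\<leftarrow>es. [:- e, 1:])"
    using char_poly_factorized[OF A] by blast
  obtain B P Q where dec: "schur_decomposition A es = (B, P, Q)" by (metis prod_cases3)
  from schur_decomposition[OF A es dec]
  have sim: "similar_mat_wit A B P Q" and diag: "diag_mat B = es" by auto
  note D = similar_mat_witD2[OF A sim]
  have "mat_trace A = mat_trace (P * (B * Q))" using D by (simp add: assoc_mult_mat)
  also have "\<dots> = mat_trace ((B * Q) * P)"
    using D by (intro mat_trace_mult_commute[of _ n n]) auto
  also have "(B * Q) * P = B" using D by (simp add: assoc_mult_mat[of _ n n _ n _ n])
  also have "mat_trace B = sum_list es"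
    unfolding diag[symmetric] mat_trace_def diag_mat_def
    by (simp add: sum_list_sum_nth atLeast0LessThan)
  finally show ?thesis unfolding es proots_prod_linear by (simp add: sum_mset_sum_list)
qed

section \<open>Nonnegativity\<close>

lemma sum_nonneg_Reals:
  assumes "\<And>i. i \<in> I \<Longrightarrow> f i \<in> \<real>\<^sub>\<ge>\<^sub>0"
  shows "sum f I \<in> (\<real>\<^sub>\<ge>\<^sub>0 :: complex set)"
  using assms by (induction I rule: infinite_finite_induct) auto

lemma nonneg_matrix_iff:
  "A \<in> carrier_mat n m \<Longrightarrow> nonneg_matrix A \<longleftrightarrow> (\<forall>i<n. \<forall>j<m. A $$ (i, j) \<in> \<real>\<^sub>\<ge>\<^sub>0)"
  unfolding nonneg_matrix_def by (auto intro!: elements_matI)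

lemma nonneg_matrix_mult:
  assumes "A \<in> carrier_mat n k" "B \<in> carrier_mat k m" "nonneg_matrix A" "nonneg_matrix B"
  shows "nonneg_matrix (A * B)"
  using assms
  by (subst nonneg_matrix_iff[of _ n m])
     (auto simp: nonneg_matrix_iff scalar_prod_def intro!: sum_nonneg_Reals nonneg_Reals_mult_I)

lemma nonneg_matrix_pow:
  assumes "A \<in> carrier_mat n n" "nonneg_matrix A"
  shows "nonneg_matrix (A ^\<^sub>m k)"
proof (induction k)
  case 0
  show ?case using assms(1) by (auto simp: nonneg_matrix_iff[of _ n n])
next
  case (Suc k)
  thus ?case using assms by (auto intro!: nonneg_matrix_mult[of _ n n])
qed

section \<open>Simultaneous diagonalization by \<open>S\<close>\<close>

lemma matrix_inverse_props:
  assumes S: "S \<in> carrier_mat n n" and det: "det S \<noteq> 0"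
  shows "S * matrix_inverse S = 1\<^sub>m n" "matrix_inverse S * S = 1\<^sub>m n"
    "matrix_inverse S \<in> carrier_mat n n"
proof -
  have "mat_inverse S \<noteq> None"
    using mat_inverse(1)[OF S, of "()"] det_non_zero_imp_unit[OF S det, of "()"] by metis
  then obtain T where T: "mat_inverse S = Some T" by blast
  from mat_inverse(2)[OF S T] T
  show "S * matrix_inverse S = 1\<^sub>m n" "matrix_inverse S * S = 1\<^sub>m n"
    "matrix_inverse S \<in> carrier_mat n n"
    by (auto simp: matrix_inverse_def)
qed

lemma invertible_mat_if_det_nonzero:
  fixes S :: "complex mat"
  assumes "S \<in> carrier_mat n n" "det S \<noteq> 0"
  shows "invertible_mat S"
  using matrix_inverse_props[OF assms] assms(1)
  by (auto simp: invertible_mat_def inverts_mat_def)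

text \<open>A vector in the kernel of the transpose is the coefficient vector of a polynomial of degree
  below \<open>n\<close> that vanishes at all \<open>n\<close> nodes.\<close>

lemma det_vandermonde_nonzero:
  fixes lam :: "complex vec"
  assumes "inj_on (vec_index lam) {..<n}"
  shows "det (vandermonde n lam) \<noteq> 0"
proof
  let ?V = "vandermonde n lam"
  have V: "?V \<in> carrier_mat n n" by (simp add: vandermonde_def)
  assume "det ?V = 0"
  hence "det (transpose_mat ?V) = 0" using det_transpose[OF V] by simp
  then obtain v where v: "v \<in> carrier_vec n" "v \<noteq> 0\<^sub>v n"
    and ker: "transpose_mat ?V *\<^sub>v v = 0\<^sub>v n"
    using det_0_iff_vec_prod_zero[of "transpose_mat ?V" n] V by auto
  define q where "q = (\<Sum>i<n. monom (v $ i) i)"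
  have coeff: "coeff q i = (if i < n then v $ i else 0)" for i
    by (simp add: q_def coeff_sum)
  have "poly q (lam $ j) = 0" if "j < n" for j
  proof -
    have "(transpose_mat ?V *\<^sub>v v) $ j = 0" using ker that by simp
    thus ?thesis using that v(1) V
      by (simp add: q_def poly_sum poly_monom scalar_prod_def vandermonde_def atLeast0LessThan
          mult.commute)
  qed
  hence sub: "vec_index lam ` {..<n} \<subseteq> {x. poly q x = 0}" by auto
  have "q \<noteq> 0"
  proof
    assume "q = 0"
    hence "v $ i = 0" if "i < n" for i using coeff[of i] that by simp
    hence "v = 0\<^sub>v n" using v(1) by (intro eq_vecI) auto
    thus False using v(2) by simp
  qed
  moreover have "n > 0" using v by (intro gr0I) auto
  have "degree q \<le> n - 1" by (rule degree_le) (auto simp: coeff)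
  hence "degree q < n" using \<open>n > 0\<close> by linarith
  moreover have "n \<le> card {x. poly q x = 0}"
    using card_mono[OF poly_roots_finite[OF \<open>q \<noteq> 0\<close>] sub] card_image[OF assms] by simp
  ultimately show False using card_poly_roots_bound[of q] by simp
qed

text \<open>Identifies \<open>M_mat n S x\<close> from its eigenvector equation, so that the inverse of \<open>S\<close> is never
  computed.\<close>

lemma M_mat_eqI:
  fixes x :: "complex vec"
  assumes S: "S \<in> carrier_mat n n" and det: "det S \<noteq> 0" and A: "A \<in> carrier_mat n n"
    and eq: "A * S = S * mat_diag n (\<lambda>i. x $ i)"
  shows "M_mat n S x = A"
proof -
  note T = matrix_inverse_props[OF S det]
  have "M_mat n S x = (A * S) * matrix_inverse S" by (simp add: M_mat_def eq)
  also have "\<dots> = A" using T S A by (simp add: assoc_mult_mat[of _ n n _ n _ n])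
  finally show ?thesis .
qed

lemma M_mat_carrier:
  assumes "S \<in> carrier_mat n n" "det S \<noteq> 0"
  shows "M_mat n S x \<in> carrier_mat n n"
  using matrix_inverse_props[OF assms] assms(1)
  by (simp add: M_mat_def mult_carrier_mat[of _ n n])

lemma M_mat_mult_similarity:
  assumes S: "S \<in> carrier_mat n n" and det: "det S \<noteq> 0"
  shows "M_mat n S x * S = S * mat_diag n (\<lambda>i. x $ i)"
proof -
  note T = matrix_inverse_props[OF S det]
  show ?thesis unfolding M_mat_def using T S
    by (simp add: assoc_mult_mat[of _ n n _ n _ n] mult_carrier_mat[of _ n n]
        right_mult_one_mat[of _ n n])
qed

text \<open>The entries are linear in \<open>x\<close>; this is what makes the spectracone a convex cone.\<close>

lemma M_mat_entry:
  assumes S: "S \<in> carrier_mat n n" and det: "det S \<noteq> 0" and ab: "a < n" "b < n"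
  shows "M_mat n S x $$ (a, b) = (\<Sum>j<n. x $ j * (S $$ (a, j) * matrix_inverse S $$ (j, b)))"
  unfolding M_mat_def mat_diag_mult_right[OF S]
  using matrix_inverse_props[OF S det] S ab
  by (simp add: scalar_prod_def atLeast0LessThan algebra_simps)

lemma spectracone_combination:
  fixes x :: "nat \<Rightarrow> complex vec"
  assumes S: "S \<in> carrier_mat n n" and det: "det S \<noteq> 0"
    and x: "\<And>i. i < m \<Longrightarrow> x i \<in> spectracone n S" and c: "\<And>i. i < m \<Longrightarrow> c i \<ge> 0"
  shows "vec n (\<lambda>j. \<Sum>i<m. complex_of_real (c i) * x i $ j) \<in> spectracone n S"
    (is "?y \<in> _")
proof -
  have "M_mat n S ?y $$ (a, b) \<in> \<real>\<^sub>\<ge>\<^sub>0" if ab: "a < n" "b < n" for a b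
  proof -
    have "M_mat n S ?y $$ (a, b) = (\<Sum>i<m. of_real (c i) * M_mat n S (x i) $$ (a, b))"
      unfolding M_mat_entry[OF S det ab]
      by (simp add: sum_distrib_left sum_distrib_right mult.assoc) (rule sum.swap)
    also have "\<dots> \<in> \<real>\<^sub>\<ge>\<^sub>0"
      using x c ab M_mat_carrier[OF S det]
      by (intro sum_nonneg_Reals nonneg_Reals_mult_I)
         (auto simp: spectracone_def nonneg_matrix_iff[of _ n n])
    finally show ?thesis .
  qed
  thus ?thesis using M_mat_carrier[OF S det]
    by (simp add: spectracone_def nonneg_matrix_iff[of _ n n])
qed

text \<open>The inclusion of the spectracone in the row cone comes from the row of ones: it makes row 0 of
  \<open>S * D\<^sub>x\<close> equal to \<open>x\<close>, so row 0 of \<open>M\<^sub>x * S = S * D\<^sub>x\<close> expresses \<open>x\<close> through the rows of \<open>S\<close>. The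
  other inclusion holds because the spectracone is a convex cone.\<close>

lemma spectracone_eq_row_cone:
  assumes S: "S \<in> carrier_mat n n" and det: "det S \<noteq> 0" and n: "n > 0"
    and ones: "row S 0 = ones_vec n"
    and rows: "\<And>i. i < n \<Longrightarrow> row S i \<in> spectracone n S"
  shows "spectracone n S = row_cone n S"
proof
  show "row_cone n S \<subseteq> spectracone n S"
  proof
    fix y assume "y \<in> row_cone n S"
    then obtain c where "\<forall>i<n. c i \<ge> 0"
      and "y = vec n (\<lambda>j. \<Sum>i<n. complex_of_real (c i) * row S i $ j)"
      unfolding row_cone_def by auto
    thus "y \<in> spectracone n S" using spectracone_combination[OF S det, of n "row S" c] rows by simp
  qed
  show "spectracone n S \<subseteq> row_cone n S"
  proof
    fix x assume x: "x \<in> spectracone n S"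
    let ?M = "M_mat n S x"
    have M: "?M \<in> carrier_mat n n" by (rule M_mat_carrier[OF S det])
    define c where "c i = Re (?M $$ (0, i))" for i
    have nn: "?M $$ (0, i) \<in> \<real>\<^sub>\<ge>\<^sub>0" if "i < n" for i
      using x that n M by (auto simp: spectracone_def nonneg_matrix_iff[of _ n n])
    hence c: "c i \<ge> 0" "complex_of_real (c i) = ?M $$ (0, i)" if "i < n" for i
      using that nn[of i] by (auto simp: c_def complex_nonneg_Reals_iff complex_eq_iff)
    have one: "S $$ (0, j) = 1" if "j < n" for j
      using arg_cong[OF ones, of "\<lambda>v :: complex vec. v $ j"] that n S by (simp add: ones_vec_def)
    have "x $ j = (\<Sum>i<n. complex_of_real (c i) * row S i $ j)" if j: "j < n" for j
    proof -
      have "(?M * S) $$ (0, j) = (S * mat_diag n (\<lambda>i. x $ i)) $$ (0, j)"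
        by (simp add: M_mat_mult_similarity[OF S det])
      also have "\<dots> = x $ j" unfolding mat_diag_mult_right[OF S] using j n one by simp
      finally have "x $ j = (\<Sum>i<n. ?M $$ (0, i) * S $$ (i, j))"
        using M S j n by (simp add: scalar_prod_def atLeast0LessThan)
      thus ?thesis using c j S by simp
    qed
    hence "x = vec n (\<lambda>j. \<Sum>i<n. complex_of_real (c i) * row S i $ j)"
      using x by (intro eq_vecI) (auto simp: spectracone_def)
    thus "x \<in> row_cone n S" unfolding row_cone_def using c by blast
  qed
qed

section \<open>Irreducibility of matrices carrying a Hamiltonian cycle\<close>

lemma perm_conjugate_entry:
  assumes p: "p permutes {0..<n}" and A: "A \<in> carrier_mat n n" and ab: "a < n" "b < n"
  shows "(perm_matrix n p * A * transpose_mat (perm_matrix n p)) $$ (a, b) = A $$ (p a, p b)"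
proof -
  have lt: "p a < n" "p b < n" using permutes_in_image[OF p] ab by auto
  have "(perm_matrix n p * A) $$ (a, j) = A $$ (p a, j)" if "j < n" for j
    using that ab A lt
    by (simp add: perm_matrix_def scalar_prod_def if_distrib[of "\<lambda>x. x * _"] cong: if_cong)
  thus ?thesis using ab A lt
    by (simp add: perm_matrix_def scalar_prod_def if_distrib[of "\<lambda>x. _ * x"] cong: if_cong)
qed

text \<open>A block upper triangular form yields a proper subset \<open>J\<close> of the indices that no nonzero entry
  leaves. A cycle through all indices forces such a nonempty \<open>J\<close> to contain every index.\<close>

lemma irreducible_matrix_if_cycle:
  assumes A: "A \<in> carrier_mat n n"
    and step: "\<And>i. Suc i < n \<Longrightarrow> A $$ (i, Suc i) \<noteq> 0"
    and wrap: "A $$ (n - 1, 0) \<noteq> 0"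
  shows "irreducible_matrix n A"
  unfolding irreducible_matrix_def
proof (intro conjI A notI)
  assume "reducible_matrix n A"
  then obtain p k B C D where p: "p permutes {0..<n}" and k: "0 < k" "k < n"
    and B: "B \<in> carrier_mat k k" and C: "C \<in> carrier_mat k (n - k)"
    and D: "D \<in> carrier_mat (n - k) (n - k)"
    and eq: "perm_matrix n p * A * transpose_mat (perm_matrix n p) =
               four_block_mat B C (0\<^sub>m (n - k) k) D"
    unfolding reducible_matrix_def by blast
  \<comment> \<open>The indices permuted into the lower diagonal block; because of the zero block to the left of
      it, no nonzero entry leads out of \<open>J\<close>.\<close>
  define J where "J = p ` {k..<n}"
  have zero: "A $$ (p a, p b) = 0" if "a \<in> {k..<n}" "b < k" for a b
  proof -
    have "a - k < n - k" using that k by auto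
    thus ?thesis using that k B C D eq perm_conjugate_entry[OF p A, of a b] by simp
  qed
  have closed: "j \<in> J" if i: "i \<in> J" and j: "j < n" and ne: "A $$ (i, j) \<noteq> 0" for i j
  proof -
    obtain b where b: "b < n" "j = p b"
      using j permutes_image[OF p] by (metis atLeast0LessThan imageE lessThan_iff)
    obtain a where a: "a \<in> {k..<n}" "i = p a" using i by (auto simp: J_def)
    have "\<not> b < k" using zero[OF a(1)] ne a b by auto
    thus ?thesis using b by (auto simp: J_def)
  qed
  have up: "i + d \<in> J" if "i \<in> J" "i + d < n" for i d
    using that
  proof (induction d)
    case (Suc d)
    thus ?case using closed[of "i + d" "Suc (i + d)"] step[of "i + d"] by simp
  qed simp
  have start: "p (n - 1) \<in> J" using k by (auto simp: J_def)
  have "p (n - 1) < n" using permutes_in_image[OF p] k by auto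
  hence "n - 1 \<in> J" using up[OF start, of "n - 1 - p (n - 1)"] k by simp
  hence "0 \<in> J" using closed[of "n - 1" 0] wrap k by simp
  moreover have "p 0 < n" using permutes_in_image[OF p] k by auto
  ultimately have "p 0 \<in> J" using up[of 0 "p 0"] by simp
  then obtain a where "a \<in> {k..<n}" "p a = p 0" by (auto simp: J_def)
  thus False using k permutes_inj[OF p] by (auto dest: injD)
qed

section \<open>Extremality from vanishing trace\<close>

text \<open>The sum is the trace of a nonnegative matrix.\<close>

lemma SL1_sum_nonneg:
  fixes x :: "complex vec"
  assumes "x \<in> SL1 n"
  shows "(\<Sum>i<n. x $ i) \<in> \<real>\<^sub>\<ge>\<^sub>0"
proof -
  obtain A where A: "A \<in> carrier_mat n n" "nonneg_matrix A"
    and sp: "mset (list_of_vec x) = proots (char_poly A)" and x: "x \<in> carrier_vec n"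
    using assms by (auto simp: SL1_def stochastic_matrix_def)
  have "(\<Sum>i<n. x $ i) = sum_list (list_of_vec x)"
    using x by (simp add: sum_list_sum_nth list_of_vec_index atLeast0LessThan)
  also have "\<dots> = mat_trace A"
    using mat_trace_eq_sum_spectrum[OF A(1)] by (simp add: sp[symmetric] sum_mset_sum_list)
  also have "\<dots> \<in> \<real>\<^sub>\<ge>\<^sub>0"
    unfolding mat_trace_def using A by (intro sum_nonneg_Reals) (auto simp: nonneg_matrix_iff[of _ n n])
  finally show ?thesis .
qed

text \<open>If \<open>y\<close> starts with 1 and continues with \<open>\<gamma>\<close> times the tail of \<open>x\<close>, then its coordinates sum to
  \<open>1 - \<gamma>\<close>, because the tail of \<open>x\<close> sums to \<open>-1\<close>. For \<open>\<gamma> > 1\<close> this contradicts \<open>SL1_sum_nonneg\<close>.\<close>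

lemma extremal_point_if_sum_zero:
  fixes x :: "complex vec"
  assumes x: "x \<in> SL1 n" and n: "n > 0" and sum: "(\<Sum>i<n. x $ i) = 0"
  shows "extremal_point n x"
  unfolding extremal_point_def
proof (intro conjI allI impI notI x)
  fix \<gamma> :: real
  assume \<gamma>: "\<gamma> > 1" and "complex_of_real \<gamma> \<cdot>\<^sub>v proj1 x \<in> proj1 ` SL1 n"
  then obtain y where y: "y \<in> SL1 n" and eq: "proj1 y = of_real \<gamma> \<cdot>\<^sub>v proj1 x" by auto
  obtain m where m: "n = Suc m" using n by (cases n) auto
  have dims: "dim_vec x = Suc m" "dim_vec y = Suc m" "x $ 0 = 1" "y $ 0 = 1"
    using x y m by (auto simp: SL1_def)
  have "y $ Suc i = of_real \<gamma> * x $ Suc i" if "i < m" for i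
    using arg_cong[OF eq, of "\<lambda>v :: complex vec. v $ i"] that dims by (simp add: proj1_def)
  hence "(\<Sum>i<n. y $ i) = 1 + of_real \<gamma> * (\<Sum>i<m. x $ Suc i)"
    using dims by (simp add: m sum.lessThan_Suc_shift sum_distrib_left del: sum.lessThan_Suc)
  also have "(\<Sum>i<m. x $ Suc i) = - 1"
    using sum dims by (simp add: m sum.lessThan_Suc_shift add_eq_0_iff del: sum.lessThan_Suc)
  finally have "(\<Sum>i<n. y $ i) = of_real (1 - \<gamma>)" by simp
  thus False using SL1_sum_nonneg[OF y] \<gamma> by (simp add: complex_nonneg_Reals_iff)
qed

section \<open>The companion matrix\<close>

text \<open>The companion matrix of \<open>f_poly n \<alpha>\<close>, oriented so that it shifts the column of powers
  \<open>1, t, \<dots>, t ^ (n - 1)\<close> of a zero \<open>t\<close> to \<open>t, t ^ 2, \<dots>, t ^ n\<close>; its last row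
  encodes \<open>t ^ n = \<alpha> + (1 - \<alpha>) * t\<close>.\<close>

definition companion :: "nat \<Rightarrow> real \<Rightarrow> complex mat" where
  "companion n \<alpha> = mat n n (\<lambda>(i, j).
     if Suc i < n then (if j = Suc i then 1 else 0)
     else if j = 0 then of_real \<alpha> else if j = 1 then of_real (1 - \<alpha>) else 0)"

lemma companion_carrier: "companion n \<alpha> \<in> carrier_mat n n"
  by (simp add: companion_def)

text \<open>Serves both for the row sums (\<open>v\<close> constant) and for the action on a column of powers.\<close>

lemma companion_row_sum:
  assumes "n \<ge> 2" "i < n"
  shows "(\<Sum>j<n. companion n \<alpha> $$ (i, j) * v j) =
    (if Suc i < n then v (Suc i) else of_real \<alpha> * v 0 + of_real (1 - \<alpha>) * v 1)"
proof (cases "Suc i < n")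
  case True
  thus ?thesis using assms
    by (simp add: companion_def if_distrib[of "\<lambda>x. x * _"] cong: if_cong)
next
  case False
  have "(\<Sum>j<n. companion n \<alpha> $$ (i, j) * v j) = (\<Sum>j\<in>{0, 1}. companion n \<alpha> $$ (i, j) * v j)"
    using assms False by (intro sum.mono_neutral_right) (auto simp: companion_def)
  thus ?thesis using assms False by (simp add: companion_def)
qed

lemma companion_nonneg:
  assumes "0 \<le> \<alpha>" "\<alpha> \<le> 1"
  shows "nonneg_matrix (companion n \<alpha>)"
  using assms by (auto simp: nonneg_matrix_iff[OF companion_carrier])
     (auto simp: companion_def complex_nonneg_Reals_iff)

lemma companion_stochastic:
  assumes "n \<ge> 2" "0 \<le> \<alpha>" "\<alpha> \<le> 1"
  shows "stochastic_matrix n (companion n \<alpha>)"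
  unfolding stochastic_matrix_def
  using companion_row_sum[OF assms(1), of _ \<alpha> "\<lambda>_. 1"] companion_nonneg assms
  by (auto simp: companion_carrier)

text \<open>The cycle is \<open>0 \<rightarrow> 1 \<rightarrow> \<dots> \<rightarrow> n - 1 \<rightarrow> 0\<close>; the entry \<open>\<alpha>\<close> closes it.\<close>

lemma companion_irreducible:
  assumes "n \<ge> 2" "\<alpha> \<noteq> 0"
  shows "irreducible_matrix n (companion n \<alpha>)"
  using assms by (intro irreducible_matrix_if_cycle[OF companion_carrier]) (auto simp: companion_def)

text \<open>For \<open>n \<ge> 3\<close> the entries of the last row in columns 0 and 1 lie off the diagonal.\<close>

lemma mat_trace_companion:
  assumes "n \<ge> 3"
  shows "mat_trace (companion n \<alpha>) = 0"
  using assms by (auto simp: mat_trace_def companion_def intro!: sum.neutral)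

lemma vandermonde_carrier: "vandermonde n lam \<in> carrier_mat n n"
  by (simp add: vandermonde_def)

lemma row_vandermonde: "i < n \<Longrightarrow> row (vandermonde n lam) i = vec n (\<lambda>j. (lam $ j) ^ i)"
  by (intro eq_vecI) (auto simp: vandermonde_def)

lemma companion_vandermonde:
  fixes lam :: "complex vec"
  assumes n: "n \<ge> 2" and roots: "\<And>j. j < n \<Longrightarrow> poly (f_poly n \<alpha>) (lam $ j) = 0"
  shows "companion n \<alpha> * vandermonde n lam = vandermonde n lam * mat_diag n (\<lambda>j. lam $ j)"
proof (rule eq_matI)
  fix i j assume "i < dim_row (vandermonde n lam * mat_diag n (\<lambda>j. lam $ j))"
    "j < dim_col (vandermonde n lam * mat_diag n (\<lambda>j. lam $ j))"
  hence ij: "i < n" "j < n" by (auto simp: vandermonde_def mat_diag_def)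
  have root: "lam $ j ^ n = of_real \<alpha> + of_real (1 - \<alpha>) * lam $ j"
    using roots[OF ij(2)] by (simp add: f_poly_def poly_monom algebra_simps)
  have "(companion n \<alpha> * vandermonde n lam) $$ (i, j) =
      (\<Sum>k<n. companion n \<alpha> $$ (i, k) * (lam $ j) ^ k)"
    using ij companion_carrier[of n \<alpha>]
    by (simp add: vandermonde_def scalar_prod_def atLeast0LessThan)
  also have "\<dots> = (lam $ j) ^ Suc i"
  proof (cases "Suc i < n")
    case False
    hence "Suc i = n" using ij by simp
    thus ?thesis using companion_row_sum[OF n ij(1), of \<alpha> "\<lambda>k. (lam $ j) ^ k"] root
      by (simp del: power_Suc)
  qed (use companion_row_sum[OF n ij(1)] in simp)
  also have "\<dots> = (vandermonde n lam * mat_diag n (\<lambda>j. lam $ j)) $$ (i, j)"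
    unfolding mat_diag_mult_right[OF vandermonde_carrier] using ij by (simp add: vandermonde_def)
  finally show "(companion n \<alpha> * vandermonde n lam) $$ (i, j) =
    (vandermonde n lam * mat_diag n (\<lambda>j. lam $ j)) $$ (i, j)" .
qed (auto simp: companion_def vandermonde_def mat_diag_def)

lemma diagonalization_pow:
  assumes A: "A \<in> carrier_mat n n" and S: "S \<in> carrier_mat n n"
    and eq: "A * S = S * mat_diag n d"
  shows "A ^\<^sub>m k * S = S * mat_diag n (\<lambda>i. d i ^ k)"
proof (induction k)
  case (Suc k)
  have "A ^\<^sub>m Suc k * S = A ^\<^sub>m k * (A * S)"
    using A S by (simp add: assoc_mult_mat[of _ n n _ n _ n])
  also have "\<dots> = (A ^\<^sub>m k * S) * mat_diag n d"
    unfolding eq using A S by (simp add: assoc_mult_mat[of _ n n _ n _ n])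
  also have "\<dots> = S * (mat_diag n (\<lambda>i. d i ^ k) * mat_diag n d)"
    unfolding Suc using S by (simp add: assoc_mult_mat[of _ n n _ n _ n])
  finally show ?case by (simp only: mat_diag_diag power_Suc2)
qed (use A S in simp)

section \<open>The Vandermonde similarity of the trinomial\<close>

text \<open>The three cases of the theorem differ only in why the trinomial is separable, so separability
  is taken as a hypothesis here.\<close>

lemma vandermonde_ideal_extremal:
  fixes n :: nat and \<alpha> :: real and lam :: "complex vec"
  assumes n: "n \<ge> 4" and \<alpha>: "0 \<le> \<alpha>" "\<alpha> \<le> 1"
    and lam: "lam \<in> carrier_vec n" "lam $ 0 = 1"
      "mset (list_of_vec lam) = proots (f_poly n \<alpha>)"
    and sqf: "rsquarefree (f_poly n \<alpha>)"
  defines "S \<equiv> vandermonde n lam"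
  shows "invertible_mat S" "spectracone n S = row_cone n S" "has_extremal_point n S"
    "\<alpha> \<noteq> 0 \<Longrightarrow> perron_similarity n S"
proof -
  let ?C = "companion n \<alpha>"
  have S: "S \<in> carrier_mat n n" by (simp add: S_def vandermonde_carrier)
  have C: "?C \<in> carrier_mat n n" by (rule companion_carrier)
  have "f_poly n \<alpha> \<noteq> 0" using sqf by (simp add: rsquarefree_def)
  have roots: "poly (f_poly n \<alpha>) (lam $ j) = 0" if "j < n" for j
  proof -
    have "lam $ j \<in># mset (list_of_vec lam)"
      using that lam(1) by (auto simp: set_list_of_vec intro: vec_setI)
    thus ?thesis unfolding lam(3) using \<open>f_poly n \<alpha> \<noteq> 0\<close> by simp
  qed
  have dist: "distinct (list_of_vec lam)" by (rule distinct_roots_list[OF sqf lam(3)])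
  have inj: "inj_on (vec_index lam) {..<n}"
    using dist lam(1) by (intro inj_onI)
      (metis carrier_vecD lessThan_iff length_list_of_vec list_of_vec_index nth_eq_iff_index_eq)
  have det: "det S \<noteq> 0" unfolding S_def by (rule det_vandermonde_nonzero[OF inj])
  show inv: "invertible_mat S" by (rule invertible_mat_if_det_nonzero[OF S det])
  have CS: "?C * S = S * mat_diag n (\<lambda>j. lam $ j)"
    unfolding S_def using n roots by (intro companion_vandermonde) auto
  have Mpow: "M_mat n S (row S i) = ?C ^\<^sub>m i" if "i < n" for i
  proof (rule M_mat_eqI[OF S det])
    have "mat_diag n (\<lambda>j. row S i $ j) = mat_diag n (\<lambda>j. (lam $ j) ^ i)"
      using that by (auto simp: S_def row_vandermonde mat_diag_def intro!: eq_matI)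
    thus "?C ^\<^sub>m i * S = S * mat_diag n (\<lambda>j. row S i $ j)"
      using diagonalization_pow[OF C S CS, of i] by simp
  qed (use C in simp)
  have rows: "row S i \<in> spectracone n S" if "i < n" for i
    using Mpow[OF that] nonneg_matrix_pow[OF C companion_nonneg[OF \<alpha>], of i] row_carrier_vec[OF that S]
    by (simp add: spectracone_def)
  have "row S 0 = ones_vec n" using n by (simp add: S_def row_vandermonde ones_vec_def)
  thus cone: "spectracone n S = row_cone n S"
    using n rows by (intro spectracone_eq_row_cone[OF S det]) auto
  \<comment> \<open>The zeros form row 1 of \<open>S\<close>, so they lie in the spectracone with matrix \<open>C\<close>.\<close>
  have row1: "row S 1 = lam"
    using n lam(1) by (auto simp: S_def row_vandermonde intro!: eq_vecI)
  have Mlam: "M_mat n S lam = ?C" using Mpow[of 1] n C unfolding row1 by simp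
  show "perron_similarity n S" if "\<alpha> \<noteq> 0"
    unfolding perron_similarity_def
  proof (intro conjI S inv bexI[of _ "mat_diag n (\<lambda>j. lam $ j)"])
    show "diagonal_mat (mat_diag n (\<lambda>j. lam $ j))" by (auto simp: diagonal_mat_def mat_diag_def)
    show "irreducible_matrix n (S * mat_diag n (\<lambda>j. lam $ j) * matrix_inverse S)"
      using Mlam companion_irreducible[of n \<alpha>] n that by (simp add: M_mat_def)
    show "nonneg_matrix (S * mat_diag n (\<lambda>j. lam $ j) * matrix_inverse S)"
      using Mlam companion_nonneg[OF \<alpha>, of n] by (simp add: M_mat_def)
  qed simp
  have stoch: "stochastic_matrix n ?C" using companion_stochastic n \<alpha> by simp
  have "?C *\<^sub>v ones_vec n = ones_vec n"
    using stoch C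
    by (intro eq_vecI) (auto simp: stochastic_matrix_def ones_vec_def scalar_prod_def atLeast0LessThan)
  hence lamP: "lam \<in> spectratope n S"
    using rows[of 1] row1 n Mlam by (simp add: spectratope_def)
  have "similar_mat_wit ?C (mat_diag n (\<lambda>j. lam $ j)) S (matrix_inverse S)"
    using Mlam matrix_inverse_props[OF S det] S C
    by (intro similar_mat_witI[of _ _ n]) (auto simp: M_mat_def)
  hence "char_poly ?C = char_poly (mat_diag n (\<lambda>j. lam $ j))"
    by (intro char_poly_similar) (auto simp: similar_mat_def)
  also have "\<dots> = (\<Prod>a\<leftarrow>diag_mat (mat_diag n (\<lambda>j. lam $ j)). [:- a, 1:])"
    by (rule char_poly_upper_triangular[of _ n]) (auto simp: mat_diag_def)
  also have "diag_mat (mat_diag n (\<lambda>j. lam $ j)) = list_of_vec lam"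
    using lam(1) by (intro nth_equalityI) (auto simp: diag_mat_def mat_diag_def list_of_vec_index)
  finally have spec: "proots (char_poly ?C) = mset (list_of_vec lam)"
    by (simp add: proots_prod_linear)
  hence SL: "lam \<in> SL1 n" using stoch lam by (auto simp: SL1_def)
  have "(\<Sum>i<n. lam $ i) = sum_list (list_of_vec lam)"
    using lam(1) by (simp add: sum_list_sum_nth list_of_vec_index atLeast0LessThan)
  also have "\<dots> = mat_trace ?C"
    using mat_trace_eq_sum_spectrum[OF C] by (simp add: spec sum_mset_sum_list)
  also have "\<dots> = 0" using n by (simp add: mat_trace_companion)
  finally have "extremal_point n lam" using SL n by (intro extremal_point_if_sum_zero) auto
  moreover have "lam \<noteq> ones_vec n"
  proof
    assume "lam = ones_vec n"
    hence "lam $ 0 = lam $ 1" using n by (simp add: ones_vec_def)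
    thus False using inj n by (auto dest: inj_onD)
  qed
  ultimately show "has_extremal_point n S" using lamP by (auto simp: has_extremal_point_def)
qed

theorem corollary6p1:
  fixes n :: nat and \<alpha> \<beta> :: real and lam :: "complex vec" and S :: "complex mat"
  assumes "n \<ge> 4"
    and "0 \<le> \<alpha>" and "\<alpha> \<le> 1"
    and "\<beta> = 1 - \<alpha>"
    and "lam \<in> carrier_vec n"
    and "lam $ 0 = 1"
    and "mset (list_of_vec lam) = proots (f_poly n \<alpha>)"
    and "S = vandermonde n lam"
  shows
    "(even n \<longrightarrow>
        (\<alpha> \<noteq> 0 \<longrightarrow> ideal_similarity n S \<and> extremal_similarity n S) \<and>
        (\<alpha> = 0 \<longrightarrow> invertible_mat S \<and> spectracone n S = row_cone n S \<and> has_extremal_point n S)) \<and>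
     (odd n \<and> \<alpha> \<ge> \<beta> \<longrightarrow>
        ideal_similarity n S \<and> extremal_similarity n S) \<and>
     (odd n \<and> \<alpha> < \<beta> \<and> (real n - 1) ^ (n - 1) * \<beta> ^ n - real n ^ n * \<alpha> ^ (n - 1) \<noteq> 0 \<longrightarrow>
        (\<alpha> \<noteq> 0 \<longrightarrow> ideal_similarity n S \<and> extremal_similarity n S) \<and>
        (\<alpha> = 0 \<longrightarrow> invertible_mat S \<and> spectracone n S = row_cone n S \<and> has_extremal_point n S))"
proof -
  have sqf: "rsquarefree (f_poly n \<alpha>)"
    if "even n \<or> (real n - 1) ^ (n - 1) * \<beta> ^ n \<noteq> real n ^ n * \<alpha> ^ (n - 1)"
    unfolding rsquarefree_roots
    using f_poly_double_root[of n \<alpha>] that assms(1-4) by auto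
  have main: "invertible_mat S \<and> spectracone n S = row_cone n S \<and> has_extremal_point n S \<and>
      (\<alpha> \<noteq> 0 \<longrightarrow> ideal_similarity n S \<and> extremal_similarity n S)"
    if "even n \<or> (real n - 1) ^ (n - 1) * \<beta> ^ n \<noteq> real n ^ n * \<alpha> ^ (n - 1)"
    using vandermonde_ideal_extremal[OF assms(1-3,5-7) sqf[OF that]]
    by (auto simp: assms(8) ideal_similarity_def extremal_similarity_def)
  have "(real n - 1) ^ (n - 1) * \<beta> ^ n \<noteq> real n ^ n * \<alpha> ^ (n - 1)" "\<alpha> \<noteq> 0" if "\<alpha> \<ge> \<beta>"
    using critical_value_bound[of n \<beta> \<alpha>] that assms(1-4) by auto
  with main show ?thesis by auto
qed

end
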